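(* Let $K$ be a field with $\mathrm{char}(K)=0$ and $q\in K-\{0\}$. Let $A=M_q(2)$ (the coordinate algebra of the quantum matrix space) be the $K$-algebra generated by $x,y,u,v$ subject to the relations $$xu=qux,\quad yu=q^{-1}uy,\quad vu=uv,\quad xv=qvx,\quad vy=qyv,\quad yx-xy=-(q-q^{-1})uv.$$ Then: 1. If $q$ is not a root of unity, then $K[xy-quv]\subseteq Z(A)$. 2. If $q$ is a root of unity of degree $l$, then $x^l$, $y^l$, $xy-quv$ and $u^iv^j$ for all integers $i,j\ge 0$ with $i+j=l$ are central elements of $A$, and the subalgebra they generate satisfies $K[x^l,y^l,xy-quv,u^iv^j\ (i+j=l)]\subseteq Z(A)$.
   Context: The algebra is the quotient of the free associative $K$-algebra on $x,y,u,v$ by the stated relations. $Z(A)$ denotes the center of $A$, and $K[\cdots]$ denotes the $K$-subalgebra generated by the listed elements. "Root of unity of degree $l$" means primitive $l$-th root of unity. *)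

theory Defs
  imports "HOL-Library.Poly_Mapping" "HOL-Algebra.QuotRing" "HOL-Algebra.Subrings" "HOL-Algebra.Module"
begin

section \<open>The free associative algebra\<close>

text \<open>The words over an alphabet, wrapped in a datatype of their own so that concatenation can be
  the (non-commutative) operation \<open>+\<close> expected by the convolution product of finitely
  supported functions in the theory Poly_Mapping.\<close>

datatype 'g free_monoid = Word (letters: "'g list")

instantiation free_monoid :: (type) monoid_add
begin

definition zero_free_monoid :: "'a free_monoid" where
  "0 = Word []"

definition plus_free_monoid :: "'a free_monoid \<Rightarrow> 'a free_monoid \<Rightarrow> 'a free_monoid" where
  "v + w = Word (letters v @ letters w)"

instance
  by standard (simp_all add: zero_free_monoid_def plus_free_monoid_def)

end

text \<open>The free associative algebra over \<open>'k\<close> on the alphabet \<open>'g\<close> is the monoid algebra of the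
  free monoid; its product is the convolution product.\<close>

type_synonym ('g, 'k) free_algebra = "'g free_monoid \<Rightarrow>\<^sub>0 'k"

definition scalar :: "'k \<Rightarrow> ('g, 'k::field) free_algebra" where
  "scalar c = Poly_Mapping.single 0 c"

definition var :: "'g \<Rightarrow> ('g, 'k::field) free_algebra" where
  "var g = Poly_Mapping.single (Word [g]) 1"

definition free_algebra_ring :: "('g, 'k::field) free_algebra ring" where
  "free_algebra_ring = \<lparr>carrier = UNIV, mult = (*), one = 1, zero = 0, add = (+)\<rparr>"

lemma ring_free_algebra: "ring (free_algebra_ring :: ('g, 'k::field) free_algebra ring)"
proof (intro ringI abelian_groupI monoidI)
  fix f :: "('g, 'k) free_algebra"
  assume "f \<in> carrier free_algebra_ring"
  show "\<exists>g\<in>carrier free_algebra_ring. g \<oplus>\<^bsub>free_algebra_ring\<^esub> f = \<zero>\<^bsub>free_algebra_ring\<^esub>"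
    by (rule bexI[of _ "- f"]) (simp_all add: free_algebra_ring_def)
qed (simp_all add: free_algebra_ring_def algebra_simps)

section \<open>Algebras given by generators and relations\<close>

definition relation_ideal :: "('g, 'k::field) free_algebra set \<Rightarrow> ('g, 'k) free_algebra set" where
  "relation_ideal S = genideal free_algebra_ring S"

text \<open>The library's genideal is the smallest two-sided ideal.\<close>

lemma ideal_relation_ideal: "ideal (relation_ideal S) free_algebra_ring"
  unfolding relation_ideal_def
  by (rule ring.genideal_ideal[OF ring_free_algebra]) (simp add: free_algebra_ring_def)

definition residue_class ::
    "('g, 'k::field) free_algebra set \<Rightarrow> ('g, 'k) free_algebra \<Rightarrow> ('g, 'k) free_algebra set" where
  "residue_class S f = relation_ideal S +>\<^bsub>free_algebra_ring\<^esub> f"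

text \<open>The quotient ring, extended by the action of the ground field. The library's record type
  module is a ring record with an additional scalar multiplication \<open>\<odot>\<close>; here it serves as the
  signature of a (non-commutative) \<open>'k\<close>-algebra.\<close>

definition presented_algebra ::
    "('g, 'k::field) free_algebra set \<Rightarrow> ('k, ('g, 'k) free_algebra set) module" where
  "presented_algebra S =
     ring.extend (free_algebra_ring Quot (relation_ideal S))
       (module.fields (\<lambda>c X. residue_class S (scalar c) \<otimes>\<^bsub>free_algebra_ring Quot (relation_ideal S)\<^esub> X))"

lemma presented_algebra_sel:
  "carrier (presented_algebra S) = carrier (free_algebra_ring Quot (relation_ideal S))"
  "mult (presented_algebra S) = mult (free_algebra_ring Quot (relation_ideal S))"
  "one (presented_algebra S) = one (free_algebra_ring Quot (relation_ideal S))"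
  "zero (presented_algebra S) = zero (free_algebra_ring Quot (relation_ideal S))"
  "add (presented_algebra S) = add (free_algebra_ring Quot (relation_ideal S))"
  "smult (presented_algebra S) c X = residue_class S (scalar c) \<otimes>\<^bsub>presented_algebra S\<^esub> X"
  by (simp_all add: presented_algebra_def ring.extend_def module.fields_def)

lemma ring_presented_algebra: "ring (presented_algebra S)"
proof -
  interpret Q: ring "free_algebra_ring Quot (relation_ideal S)"
    by (rule ideal.quotient_is_ring[OF ideal_relation_ideal])
  show ?thesis
  proof (intro ringI abelian_groupI monoidI)
    fix a assume "a \<in> carrier (presented_algebra S)"
    then show "\<exists>b\<in>carrier (presented_algebra S). b \<oplus>\<^bsub>presented_algebra S\<^esub> a = \<zero>\<^bsub>presented_algebra S\<^esub>"
      using Q.l_neg Q.a_inv_closed by (auto simp: presented_algebra_sel)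
  qed (simp_all add: presented_algebra_sel Q.m_assoc Q.a_ac Q.l_distr Q.r_distr)
qed

lemma residue_class_hom: "residue_class S \<in> ring_hom free_algebra_ring (presented_algebra S)"
  using ideal.rcos_ring_hom[OF ideal_relation_ideal, of S]
  unfolding residue_class_def[abs_def] ring_hom_def by (simp add: presented_algebra_sel)

lemma residue_class_smult:
  "c \<odot>\<^bsub>presented_algebra S\<^esub> residue_class S f = residue_class S (scalar c * f)"
  using ring_hom_mult[OF residue_class_hom, of "scalar c" f S]
  by (simp add: presented_algebra_sel(6) free_algebra_ring_def)

lemma residue_class_relation:
  assumes "f \<in> S"
  shows "residue_class S f = \<zero>\<^bsub>presented_algebra S\<^esub>"
proof -
  interpret F: ring "free_algebra_ring :: ('a, 'b) free_algebra ring" by (rule ring_free_algebra)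
  interpret I: ideal "relation_ideal S" free_algebra_ring by (rule ideal_relation_ideal)
  have "f \<in> relation_ideal S"
    using F.genideal_self[of S] assms unfolding relation_ideal_def
    by (auto simp: free_algebra_ring_def)
  then show ?thesis
    unfolding residue_class_def by (simp add: presented_algebra_sel FactRing_def I.a_rcos_const)
qed

section \<open>Center and generated subalgebras\<close>

definition center :: "('a, 'm) ring_scheme \<Rightarrow> 'a set" where
  "center R = {z \<in> carrier R. \<forall>a\<in>carrier R. z \<otimes>\<^bsub>R\<^esub> a = a \<otimes>\<^bsub>R\<^esub> z}"

text \<open>Beware that the locale subalgebra of HOL-Algebra only describes linear subspaces.\<close>

definition unital_subalgebra :: "('k, 'a, 'm) module_scheme \<Rightarrow> 'a set \<Rightarrow> bool" where
  "unital_subalgebra R B \<longleftrightarrow> subring B R \<and> (\<forall>c. \<forall>b\<in>B. c \<odot>\<^bsub>R\<^esub> b \<in> B)"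

definition generated_subalgebra :: "('k, 'a, 'm) module_scheme \<Rightarrow> 'a set \<Rightarrow> 'a set" where
  "generated_subalgebra R S = \<Inter> {B. unital_subalgebra R B \<and> S \<subseteq> B}"

section \<open>The coordinate algebra of the quantum matrix space\<close>

datatype generator = X | Y | U | V

definition qmatrix_relations :: "'k::field \<Rightarrow> (generator, 'k) free_algebra set" where
  "qmatrix_relations q =
    {var X * var U - scalar q * (var U * var X),
     var Y * var U - scalar (inverse q) * (var U * var Y),
     var V * var U - var U * var V,
     var X * var V - scalar q * (var V * var X),
     var V * var Y - scalar q * (var Y * var V),
     var Y * var X - var X * var Y - (- (scalar (q - inverse q) * (var U * var V)))}"

definition qmatrix_algebra :: "'k::field \<Rightarrow> ('k, (generator, 'k) free_algebra set) module" where
  "qmatrix_algebra q = presented_algebra (qmatrix_relations q)"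

definition qmatrix_gen :: "'k::field \<Rightarrow> generator \<Rightarrow> (generator, 'k) free_algebra set" where
  "qmatrix_gen q g = residue_class (qmatrix_relations q) (var g)"

section \<open>Roots of unity\<close>

definition root_of_unity :: "'k::field \<Rightarrow> bool" where
  "root_of_unity q \<longleftrightarrow> (\<exists>n::nat. n > 0 \<and> q ^ n = 1)"

definition primitive_root_of_unity :: "nat \<Rightarrow> 'k::field \<Rightarrow> bool" where
  "primitive_root_of_unity l q \<longleftrightarrow>
     l > 0 \<and> q ^ l = 1 \<and> (\<forall>m::nat. 0 < m \<and> m < l \<longrightarrow> q ^ m \<noteq> 1)"

end

theory Submission
  imports Defs
begin

text \<open>An element is central as soon as it commutes with the four generators. Put \<open>w = uv\<close> and
  \<open>d = xy - qw\<close>; the last relation gives \<open>yx = d + q\<^sup>-\<^sup>1 w\<close>, and \<open>xw = q\<^sup>2 wx\<close>, from which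
  \<open>d\<close> is central. Hence \<open>x\<^sup>n\<^sup>+\<^sup>1 y = x\<^sup>n (d + qw)\<close> and \<open>y x\<^sup>n\<^sup>+\<^sup>1 = (d + q\<^sup>-\<^sup>1 w) x\<^sup>n\<close>
  agree when \<open>q\<^sup>2\<^sup>n\<^sup>+\<^sup>2 = 1\<close>. The remaining commutations only multiply by powers of \<open>q\<close>,
  which are trivial when \<open>q\<^sup>l = 1\<close>.\<close>

section \<open>Centralizers and the center as subrings\<close>

definition centralizer :: "('a, 'm) ring_scheme \<Rightarrow> 'a \<Rightarrow> 'a set" where
  "centralizer R a = {b \<in> carrier R. a \<otimes>\<^bsub>R\<^esub> b = b \<otimes>\<^bsub>R\<^esub> a}"

text \<open>Through this description the center inherits closure under the ring operations from the
  centralizers, each of which is a subring.\<close>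

lemma center_eq_centralizers: "center R = carrier R \<inter> (\<Inter>a\<in>carrier R. centralizer R a)"
  unfolding center_def centralizer_def by auto

lemma (in ring) subring_centralizer:
  assumes "a \<in> carrier R"
  shows "subring (centralizer R a) R"
  using assms
  by (intro subringI)
    (auto simp: centralizer_def l_minus r_minus l_distr r_distr m_assoc, metis m_assoc)

lemma (in ring) subring_center: "subring (center R) R"
proof (rule subringI)
  show "h1 \<otimes> h2 \<in> center R" if "h1 \<in> center R" "h2 \<in> center R" for h1 h2
    using that unfolding center_eq_centralizers by (auto intro: subringE(6) subring_centralizer)
  show "h1 \<oplus> h2 \<in> center R" if "h1 \<in> center R" "h2 \<in> center R" for h1 h2
    using that unfolding center_eq_centralizers by (auto intro: subringE(7) subring_centralizer)
  show "\<ominus> h \<in> center R" if "h \<in> center R" for h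
    using that unfolding center_eq_centralizers by (auto intro: subringE(5) subring_centralizer)
qed (auto simp: center_eq_centralizers intro: subringE(3) subring_centralizer)

section \<open>Commutation up to a central factor\<close>

text \<open>The factor \<open>c\<close> is an element of the ring, not a scalar of a ground field,
  so the rules for products and powers make sense in any ring and only ask \<open>c\<close> to be
  central.\<close>

definition q_commute :: "('a, 'm) ring_scheme \<Rightarrow> 'a \<Rightarrow> 'a \<Rightarrow> 'a \<Rightarrow> bool" where
  "q_commute R c a b \<longleftrightarrow> a \<otimes>\<^bsub>R\<^esub> b = c \<otimes>\<^bsub>R\<^esub> (b \<otimes>\<^bsub>R\<^esub> a)"

context ring
begin

lemma center_closed: "c \<in> center R \<Longrightarrow> c \<in> carrier R"
  by (simp add: center_def)

lemma center_commute: "c \<in> center R \<Longrightarrow> a \<in> carrier R \<Longrightarrow> a \<otimes> c = c \<otimes> a"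
  by (simp add: center_def)

lemma center_left_commute:
  assumes "c \<in> center R" "a \<in> carrier R" "b \<in> carrier R"
  shows "a \<otimes> (c \<otimes> b) = c \<otimes> (a \<otimes> b)"
  using assms center_closed center_commute m_assoc by metis

lemma center_pow: "c \<in> center R \<Longrightarrow> c [^] (n::nat) \<in> center R"
  using subring_center by (induction n) (auto intro: subringE(3,6))

lemma q_commute_one: "a \<in> carrier R \<Longrightarrow> b \<in> carrier R \<Longrightarrow> q_commute R \<one> a b \<longleftrightarrow> a \<otimes> b = b \<otimes> a"
  by (simp add: q_commute_def)

text \<open>Moving \<open>a\<close> past \<open>b\<close> produces \<open>c\<close> in front; moving
  it past \<open>b'\<close> produces \<open>d\<close> behind \<open>b\<close>, and centrality brings
  \<open>d\<close> forward.\<close>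

lemma q_commute_mult_right:
  assumes "q_commute R c a b" "q_commute R d a b'"
    and "c \<in> center R" "d \<in> center R" "a \<in> carrier R" "b \<in> carrier R" "b' \<in> carrier R"
  shows "q_commute R (c \<otimes> d) a (b \<otimes> b')"
proof -
  note cl = assms(5-7) center_closed[OF assms(3)] center_closed[OF assms(4)]
  have "a \<otimes> (b \<otimes> b') = c \<otimes> (b \<otimes> (a \<otimes> b'))"
    using assms(1) cl unfolding q_commute_def by (metis m_assoc m_closed)
  also have "\<dots> = c \<otimes> (b \<otimes> (d \<otimes> (b' \<otimes> a)))"
    using assms(2) unfolding q_commute_def by simp
  also have "\<dots> = c \<otimes> (d \<otimes> (b \<otimes> (b' \<otimes> a)))"
    using cl center_left_commute[OF assms(4), of b "b' \<otimes> a"] by simp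
  finally show ?thesis
    using cl unfolding q_commute_def by (simp add: m_assoc)
qed

text \<open>Here \<open>a'\<close> meets \<open>b\<close> first, so \<open>d\<close> comes out
  before \<open>c\<close> and the two central factors are exchanged at the end.\<close>

lemma q_commute_mult_left:
  assumes "q_commute R c a b" "q_commute R d a' b"
    and "c \<in> center R" "d \<in> center R" "a \<in> carrier R" "a' \<in> carrier R" "b \<in> carrier R"
  shows "q_commute R (c \<otimes> d) (a \<otimes> a') b"
proof -
  note cl = assms(5-7) center_closed[OF assms(3)] center_closed[OF assms(4)]
  have "a \<otimes> a' \<otimes> b = a \<otimes> (d \<otimes> (b \<otimes> a'))"
    using assms(2) cl unfolding q_commute_def by (simp add: m_assoc)
  also have "\<dots> = d \<otimes> (a \<otimes> b \<otimes> a')"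
    using cl center_left_commute[OF assms(4), of a "b \<otimes> a'"] by (simp add: m_assoc)
  also have "\<dots> = d \<otimes> (c \<otimes> (b \<otimes> a \<otimes> a'))"
    using assms(1) cl unfolding q_commute_def by (simp add: m_assoc)
  also have "\<dots> = c \<otimes> (d \<otimes> (b \<otimes> a \<otimes> a'))"
    using cl assms(4) center_left_commute[of d c] by simp
  finally show ?thesis
    using cl unfolding q_commute_def by (simp add: m_assoc)
qed

lemma q_commute_pow_right:
  assumes "q_commute R c a b" "c \<in> center R" "a \<in> carrier R" "b \<in> carrier R"
  shows "q_commute R (c [^] (n::nat)) a (b [^] n)"
  by (induction n)
    (use assms in \<open>auto simp: q_commute_one intro!: q_commute_mult_right center_pow\<close>)

lemma q_commute_pow_left:
  assumes "q_commute R c a b" "c \<in> center R" "a \<in> carrier R" "b \<in> carrier R"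
  shows "q_commute R (c [^] (n::nat)) (a [^] n) b"
  by (induction n)
    (use assms in \<open>auto simp: q_commute_one intro!: q_commute_mult_left center_pow\<close>)

end

section \<open>Quantum determinant, powers and monomials\<close>

text \<open>Writing \<open>p\<close> for \<open>q\<close> and \<open>p'\<close> for its inverse, the relation between \<open>x\<close> and \<open>y\<close> says that the
  quantum determinant can also be computed as \<open>yx - p'uv\<close>. In this form the relations are
  invariant under exchanging \<open>(x, p)\<close> with \<open>(y, p')\<close>.\<close>

locale quantum_matrix = ring R for R (structure) +
  fixes p p' x y u v
  assumes p: "p \<in> center R" and p': "p' \<in> center R" and pp': "p \<otimes> p' = \<one>"
    and x: "x \<in> carrier R" and y: "y \<in> carrier R" and u: "u \<in> carrier R" and v: "v \<in> carrier R"
    and xu: "q_commute R p x u" and xv: "q_commute R p x v"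
    and yu: "q_commute R p' y u" and yv: "q_commute R p' y v"
    and uv: "u \<otimes> v = v \<otimes> u"
    and det_swap: "x \<otimes> y \<ominus> p \<otimes> (u \<otimes> v) = y \<otimes> x \<ominus> p' \<otimes> (u \<otimes> v)"
begin

abbreviation det where "det \<equiv> x \<otimes> y \<ominus> p \<otimes> (u \<otimes> v)"

lemmas closed = x y u v center_closed[OF p] center_closed[OF p']

lemma p'p: "p' \<otimes> p = \<one>"
  using pp' center_commute[OF p] closed by simp

text \<open>By this symmetry every fact about \<open>x\<close> yields one about \<open>y\<close>,
  with \<open>p'\<close> in the role of \<open>p\<close>; by \<open>det_swap\<close> the determinant
  stays the same.\<close>

lemma swap: "quantum_matrix R p' p y x u v"
  by unfold_locales (use p p' p'p x y u v xu xv yu yv uv det_swap in auto)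

lemma det_closed: "det \<in> carrier R"
  using closed by simp

lemma xw: "q_commute R (p \<otimes> p) x (u \<otimes> v)"
  using q_commute_mult_right[OF xu xv] closed p by simp

text \<open>The factors \<open>p\<close> and \<open>p'\<close> that \<open>x\<close> and
  \<open>y\<close> gain on crossing \<open>u\<close> cancel in \<open>xy\<close>, and
  \<open>uv\<close> commutes with \<open>u\<close>; so both terms of \<open>det\<close> lie in the
  centralizer of \<open>u\<close>, a subring.\<close>

lemma det_u: "det \<otimes> u = u \<otimes> det"
proof -
  have "q_commute R (p \<otimes> p') (x \<otimes> y) u"
    using q_commute_mult_left[OF xu yu] closed p p' by simp
  then have "x \<otimes> y \<in> centralizer R u"
    using closed by (simp add: pp' q_commute_one centralizer_def)
  moreover have "p \<otimes> (u \<otimes> v) \<in> centralizer R u"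
    using closed uv center_commute[OF p u]
    by (intro subringE(6)[OF subring_centralizer[OF u]]) (auto simp: centralizer_def)
  ultimately have "det \<in> centralizer R u"
    using subring_centralizer[OF u] unfolding a_minus_def by (meson subringE(5,7))
  then show ?thesis by (simp add: centralizer_def)
qed

lemma det_v: "det \<otimes> v = v \<otimes> det"
proof -
  \<comment> \<open>The axioms are symmetric in \<open>u\<close> and \<open>v\<close> too, since
    these commute and enter the determinant only through their product.\<close>
  have "quantum_matrix R p p' x y v u"
    by unfold_locales (use p p' pp' x y u v xu xv yu yv uv det_swap in auto)
  then show ?thesis
    using quantum_matrix.det_u uv by metis
qed

text \<open>Take \<open>det\<close> as \<open>yx - p'uv\<close> in \<open>x det\<close> and as
  \<open>xy - puv\<close> in \<open>det x\<close>. Both products contain \<open>xyx\<close>, and the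
  factor \<open>p^2\<close> from moving \<open>x\<close> across \<open>uv\<close> turns
  \<open>p'\<close> into \<open>p\<close>.\<close>

lemma det_x: "det \<otimes> x = x \<otimes> det"
proof -
  let ?w = "u \<otimes> v"
  have "x \<otimes> det = x \<otimes> (y \<otimes> x) \<ominus> p' \<otimes> (x \<otimes> ?w)"
    using closed p' unfolding det_swap
    by (simp add: a_minus_def r_distr r_minus center_left_commute)
  also have "p' \<otimes> (x \<otimes> ?w) = (p' \<otimes> p) \<otimes> (p \<otimes> (?w \<otimes> x))"
    using closed xw unfolding q_commute_def by (simp add: m_assoc)
  also have "\<dots> = p \<otimes> ?w \<otimes> x"
    using closed by (simp add: p'p m_assoc)
  also have "x \<otimes> (y \<otimes> x) \<ominus> p \<otimes> ?w \<otimes> x = det \<otimes> x"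
    using closed by (simp add: a_minus_def l_distr l_minus m_assoc)
  finally show ?thesis by simp
qed

lemma det_y: "det \<otimes> y = y \<otimes> det"
  using quantum_matrix.det_x[OF swap] det_swap by simp

text \<open>Crossing \<open>u\<close> or \<open>v\<close> costs the factor \<open>p^l = 1\<close>.
  For \<open>y\<close> the product with one adjacent \<open>x\<close> is rewritten through the
  central determinant.\<close>

lemma pow_x_commutes:
  assumes l: "0 < l" "p [^] (l::nat) = \<one>"
  shows "x [^] l \<otimes> x = x \<otimes> x [^] l" "x [^] l \<otimes> u = u \<otimes> x [^] l"
    and "x [^] l \<otimes> v = v \<otimes> x [^] l" "x [^] l \<otimes> y = y \<otimes> x [^] l"
proof -
  let ?w = "u \<otimes> v"
  show "x [^] l \<otimes> x = x \<otimes> x [^] l"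
    using closed by (simp add: nat_pow_comm[of x l 1, simplified])
  show "x [^] l \<otimes> u = u \<otimes> x [^] l" "x [^] l \<otimes> v = v \<otimes> x [^] l"
    using q_commute_pow_left[OF xu p, of l] q_commute_pow_left[OF xv p, of l] closed l
    by (simp_all add: q_commute_one)
  \<comment> \<open>One factor \<open>x\<close> is set aside to form \<open>xy\<close> or
    \<open>yx\<close>, which leaves \<open>x^n\<close> with \<open>n = l - 1\<close> to be moved;
    this is where \<open>0 < l\<close> enters.\<close>
  obtain n where n: "l = Suc n" using l(1) gr0_implies_Suc by blast
  have xn: "x [^] n \<in> carrier R" using closed by simp
  have det_xn: "x [^] n \<otimes> det = det \<otimes> x [^] n"
    using group_commutes_pow[OF det_x[symmetric]] closed by simp
  \<comment> \<open>The coefficient \<open>p\<close> of \<open>uv\<close> in \<open>xy\<close>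
    becomes \<open>p^(2n+1) = p^(2l-1)\<close> once \<open>x^n\<close> has crossed
    \<open>uv\<close>. Inserting \<open>p'p = 1\<close> completes this to
    \<open>p' p^l p^l\<close>.\<close>
  have pn: "p \<otimes> (p \<otimes> p) [^] n = p'"
  proof -
    have "p \<otimes> (p \<otimes> p) [^] n = (p' \<otimes> p) \<otimes> (p \<otimes> (p [^] n \<otimes> p [^] n))"
      using closed by (simp add: p'p pow_mult_distrib)
    also have "\<dots> = p' \<otimes> ((p \<otimes> p [^] n) \<otimes> (p \<otimes> p [^] n))"
      using closed center_left_commute[OF p, of "p [^] n" "p [^] n"] by (simp add: m_assoc)
    also have "p \<otimes> p [^] n = \<one>"
      using l(2) nat_pow_Suc2 closed n by simp
    finally show ?thesis using closed by simp
  qed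
  have xnw: "x [^] n \<otimes> ?w = (p \<otimes> p) [^] n \<otimes> (?w \<otimes> x [^] n)"
    using q_commute_pow_left[OF xw, of n] closed p subring_center
    unfolding q_commute_def by (simp add: subringE(6))
  have "x [^] l \<otimes> y = x [^] n \<otimes> (det \<oplus> p \<otimes> ?w)"
    using closed n by (simp add: m_assoc a_minus_def a_assoc l_neg)
  also have "\<dots> = det \<otimes> x [^] n \<oplus> p \<otimes> (x [^] n \<otimes> ?w)"
    using closed p xn det_closed det_xn by (simp add: r_distr center_left_commute)
  also have "p \<otimes> (x [^] n \<otimes> ?w) = p \<otimes> (p \<otimes> p) [^] n \<otimes> (?w \<otimes> x [^] n)"
    using closed by (simp add: xnw m_assoc)
  also have "\<dots> = p' \<otimes> ?w \<otimes> x [^] n"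
    using closed by (simp add: pn m_assoc)
  also have "det \<otimes> x [^] n \<oplus> p' \<otimes> ?w \<otimes> x [^] n = (det \<oplus> p' \<otimes> ?w) \<otimes> x [^] n"
    using closed det_closed by (simp add: l_distr)
  \<comment> \<open>The new coefficient \<open>p'\<close> is the one in the second form
    \<open>yx - p'uv\<close> of the determinant, so the sum is now \<open>yx\<close>.\<close>
  also have "det \<oplus> p' \<otimes> ?w = y \<otimes> x"
    using closed unfolding det_swap by (simp add: a_minus_def a_assoc l_neg)
  also have "y \<otimes> x \<otimes> x [^] n = y \<otimes> x [^] l"
    using closed n nat_pow_Suc2[of x n] by (simp add: m_assoc)
  finally show "x [^] l \<otimes> y = y \<otimes> x [^] l" .
qed

text \<open>Moving \<open>x\<close> across the monomial costs \<open>p^i p^j\<close>. The companion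
  statement for \<open>y\<close> is the first claim read in the swapped locale.\<close>

lemma monomial_commutes:
  assumes "p [^] (i + j :: nat) = \<one>"
  shows "u [^] i \<otimes> v [^] j \<otimes> x = x \<otimes> (u [^] i \<otimes> v [^] j)"
    and "u [^] i \<otimes> v [^] j \<otimes> u = u \<otimes> (u [^] i \<otimes> v [^] j)"
    and "u [^] i \<otimes> v [^] j \<otimes> v = v \<otimes> (u [^] i \<otimes> v [^] j)"
proof -
  have "q_commute R (p [^] i \<otimes> p [^] j) x (u [^] i \<otimes> v [^] j)"
    using closed p xu xv by (intro q_commute_mult_right q_commute_pow_right center_pow) auto
  then show "u [^] i \<otimes> v [^] j \<otimes> x = x \<otimes> (u [^] i \<otimes> v [^] j)"
    using assms closed by (simp add: nat_pow_mult q_commute_one)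
  have *: "a [^] (n::nat) \<in> centralizer R b"
    if "a \<in> carrier R" "b \<in> carrier R" "a \<otimes> b = b \<otimes> a" for a b n
    using that group_commutes_pow[of a b n] by (simp add: centralizer_def)
  have "u [^] i \<otimes> v [^] j \<in> centralizer R b" if "b \<in> {u, v}" for b
    using that closed uv by (intro subringE(6)[OF subring_centralizer] *) auto
  then show "u [^] i \<otimes> v [^] j \<otimes> u = u \<otimes> (u [^] i \<otimes> v [^] j)"
    and "u [^] i \<otimes> v [^] j \<otimes> v = v \<otimes> (u [^] i \<otimes> v [^] j)"
    by (auto simp: centralizer_def)
qed

end

section \<open>Induction over the free algebra\<close>

text \<open>Scalars and letters generate: a monomial is built by prefixing letters to a scalar, and
  an element by adding one monomial at a time.\<close>

lemma free_algebra_induct [case_names scalar var add mult]: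
  fixes f :: "('g, 'k::field) free_algebra"
  assumes scalar: "\<And>c. P (scalar c)" and var: "\<And>g. P (var g)"
    and add: "\<And>f g. P f \<Longrightarrow> P g \<Longrightarrow> P (f + g)" and mult: "\<And>f g. P f \<Longrightarrow> P g \<Longrightarrow> P (f * g)"
  shows "P f"
proof -
  have monomial: "P (Poly_Mapping.single (Word ws) c)" for ws and c :: 'k
  proof (induction ws)
    case Nil
    show ?case
      using scalar[of c] by (simp add: scalar_def zero_free_monoid_def)
  next
    case (Cons g ws)
    have "Poly_Mapping.single (Word (g # ws)) c = var g * Poly_Mapping.single (Word ws) c"
      by (simp add: var_def mult_single plus_free_monoid_def)
    then show ?case
      using mult[OF var Cons.IH] by simp
  qed
  show ?thesis
  proof (induction f rule: update_induct)
    case const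
    show ?case using scalar[of 0] by (simp add: scalar_def)
  next
    case (update f w c)
    \<comment> \<open>The word \<open>w\<close> lies outside the support of \<open>f\<close>, so
      setting its coefficient to \<open>c\<close> amounts to adding a monomial.\<close>
    have "Poly_Mapping.update w c f = f + Poly_Mapping.single w c"
      using update.hyps
      by (intro poly_mapping_eqI) (auto simp: lookup_update lookup_add lookup_single in_keys_iff)
    moreover have "P (Poly_Mapping.single w c)"
      using monomial[of "letters w" c] by simp
    ultimately show ?case
      using add[OF update.IH] by simp
  qed
qed

lemma scalar_commute: "scalar c * f = f * (scalar c :: ('g, 'k::field) free_algebra)"
proof (induction f rule: free_algebra_induct)
  case (mult f g)
  then show ?case by (metis mult.assoc)
qed (simp_all add: scalar_def var_def mult_single mult.commute distrib_left distrib_right)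

section \<open>Residue classes and the center of a presented algebra\<close>

context
  fixes S :: "('g, 'k::field) free_algebra set"
begin

interpretation ring "presented_algebra S"
  by (rule ring_presented_algebra)

text \<open>These are the homomorphism laws in the type-class operations of the free algebra, usable
  as rewrite rules in either direction.\<close>

lemma residue_class_simps:
  "residue_class S f \<in> carrier (presented_algebra S)"
  "residue_class S 1 = \<one>\<^bsub>presented_algebra S\<^esub>"
  "residue_class S 0 = \<zero>\<^bsub>presented_algebra S\<^esub>"
  "residue_class S (f + g) = residue_class S f \<oplus>\<^bsub>presented_algebra S\<^esub> residue_class S g"
  "residue_class S (f * g) = residue_class S f \<otimes>\<^bsub>presented_algebra S\<^esub> residue_class S g"
  "residue_class S (f - g) = residue_class S f \<ominus>\<^bsub>presented_algebra S\<^esub> residue_class S g"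
proof -
  interpret h: ring_hom_ring free_algebra_ring "presented_algebra S" "residue_class S"
    by (intro ring_hom_ringI2 ring_free_algebra ring_presented_algebra residue_class_hom)
  show closed: "residue_class S f \<in> carrier (presented_algebra S)" for f
    using h.hom_closed[of f] by (simp add: free_algebra_ring_def)
  show "residue_class S 1 = \<one>\<^bsub>presented_algebra S\<^esub>" "residue_class S 0 = \<zero>\<^bsub>presented_algebra S\<^esub>"
    using h.hom_one h.hom_zero by (simp_all add: free_algebra_ring_def)
  show add: "residue_class S (f + g) = residue_class S f \<oplus>\<^bsub>presented_algebra S\<^esub> residue_class S g" for f g
    using h.hom_add[of f g] by (simp add: free_algebra_ring_def)
  show "residue_class S (f * g) = residue_class S f \<otimes>\<^bsub>presented_algebra S\<^esub> residue_class S g"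
    using h.hom_mult[of f g] by (simp add: free_algebra_ring_def)
  \<comment> \<open>Subtraction follows from additivity applied to
    \<open>(f - g) + g\<close>.\<close>
  show "residue_class S (f - g) = residue_class S f \<ominus>\<^bsub>presented_algebra S\<^esub> residue_class S g"
    using add[of "f - g" g] closed
    by (simp add: a_minus_def a_assoc r_neg)
qed

lemma carrier_presented_algebra: "carrier (presented_algebra S) = range (residue_class S)"
  by (auto simp: presented_algebra_sel FactRing_def A_RCOSETS_def' residue_class_def
      free_algebra_ring_def)

lemma residue_class_scalar_center: "residue_class S (scalar c) \<in> center (presented_algebra S)"
proof -
  have "residue_class S (scalar c) \<otimes>\<^bsub>presented_algebra S\<^esub> residue_class S f
      = residue_class S f \<otimes>\<^bsub>presented_algebra S\<^esub> residue_class S (scalar c)" for f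
    by (metis residue_class_simps(5) scalar_commute)
  then show ?thesis
    unfolding center_def carrier_presented_algebra by blast
qed

text \<open>The centralizer of \<open>z\<close> is a subring containing the classes of scalars and
  letters, so induction over the free algebra puts every residue class into it.\<close>

lemma center_presented_algebraI:
  assumes z: "z \<in> carrier (presented_algebra S)"
    and gens: "\<And>g. z \<otimes>\<^bsub>presented_algebra S\<^esub> residue_class S (var g)
                    = residue_class S (var g) \<otimes>\<^bsub>presented_algebra S\<^esub> z"
  shows "z \<in> center (presented_algebra S)"
proof -
  have "residue_class S f \<in> centralizer (presented_algebra S) z" for f
  proof (induction f rule: free_algebra_induct)
    case (scalar c)
    show ?case
      using residue_class_scalar_center[of c] z by (auto simp: centralizer_def center_def)
  next
    case (var g)
    show ?case using gens by (simp add: centralizer_def residue_class_simps)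
  next
    case (add f g)
    then show ?case
      using subring_centralizer[OF z] by (simp add: residue_class_simps subringE(7))
  next
    case (mult f g)
    then show ?case
      using subring_centralizer[OF z] by (simp add: residue_class_simps subringE(6))
  qed
  then show ?thesis
    using z by (auto simp: carrier_presented_algebra center_def centralizer_def)
qed

text \<open>The center is itself one of the subalgebras being intersected: it is a subring, and the
  field acts through classes of scalars, which are central.\<close>

lemma generated_subalgebra_subset_center:
  assumes "T \<subseteq> center (presented_algebra S)"
  shows "generated_subalgebra (presented_algebra S) T \<subseteq> center (presented_algebra S)"
proof -
  have "unital_subalgebra (presented_algebra S) (center (presented_algebra S))"
    unfolding unital_subalgebra_def presented_algebra_sel(6)
    using subring_center residue_class_scalar_center by (auto intro: subringE(6))
  then show ?thesis
    using assms unfolding generated_subalgebra_def by blast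
qed

lemma residue_class_eqI:
  assumes "f - g \<in> S"
  shows "residue_class S f = residue_class S g"
  using residue_class_relation[OF assms] r_right_minus_eq[of "residue_class S f" "residue_class S g"]
  by (simp add: residue_class_simps)

end

section \<open>The quantum matrix algebra as an instance\<close>

lemma quantum_matrix_qmatrix_algebra:
  fixes q :: "'k::field"
  assumes "q \<noteq> 0"
  defines "r \<equiv> residue_class (qmatrix_relations q)"
  shows "quantum_matrix (qmatrix_algebra q) (r (scalar q)) (r (scalar (inverse q)))
    (qmatrix_gen q X) (qmatrix_gen q Y) (qmatrix_gen q U) (qmatrix_gen q V)"
proof -
  interpret ring "qmatrix_algebra q"
    unfolding qmatrix_algebra_def by (rule ring_presented_algebra)
  note hom = residue_class_simps[of "qmatrix_relations q", folded qmatrix_algebra_def r_def]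
  \<comment> \<open>Read backwards, the homomorphism laws collapse both sides of an axiom into
    single residue classes, which the defining relations can then compare.\<close>
  note hom_eqs = hom(2-)[symmetric]
  have inv: "scalar q * scalar (inverse q) = (1 :: (generator, 'k) free_algebra)"
    "scalar (inverse q) * scalar q = (1 :: (generator, 'k) free_algebra)"
    using assms by (simp_all add: scalar_def mult_single)
  have rel: "r f = r g" if "f - g \<in> qmatrix_relations q" for f g
    unfolding r_def by (rule residue_class_eqI[OF that])
  \<comment> \<open>The defining relation \<open>vy = q yv\<close> is solved for \<open>yv\<close>
    by multiplying with the inverse of \<open>q\<close>.\<close>
  have vy: "r (var Y * var V) = r (scalar (inverse q) * (var V * var Y))"
  proof -
    have "r (var V * var Y) = r (scalar q * (var Y * var V))"
      by (rule rel) (simp add: qmatrix_relations_def)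
    then have "r (scalar (inverse q) * (var V * var Y))
        = r (scalar (inverse q) * (scalar q * (var Y * var V)))"
      by (simp only: hom)
    then show ?thesis
      by (simp add: inv flip: mult.assoc)
  qed
  have "r (var Y * var X) = r (var X * var Y + - (scalar (q - inverse q) * (var U * var V)))"
    by (rule rel) (simp add: qmatrix_relations_def algebra_simps)
  then have "r (var Y * var X - scalar (inverse q) * (var U * var V))
      = r (var X * var Y + - (scalar (q - inverse q) * (var U * var V)) - scalar (inverse q) * (var U * var V))"
    by (simp only: hom)
  \<comment> \<open>After splitting the scalar, the two terms with the inverse of \<open>q\<close>
    cancel and \<open>xy - q uv\<close> remains.\<close>
  also have "scalar (q - inverse q) = scalar q - (scalar (inverse q) :: (generator, 'k) free_algebra)"
    by (simp add: scalar_def single_diff)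
  finally have det: "r (var X * var Y - scalar q * (var U * var V))
      = r (var Y * var X - scalar (inverse q) * (var U * var V))"
    by (simp add: algebra_simps)
  show ?thesis
  proof (unfold_locales, unfold q_commute_def qmatrix_gen_def, fold r_def, unfold hom_eqs)
    show "r (scalar q) \<in> center (qmatrix_algebra q)" "r (scalar (inverse q)) \<in> center (qmatrix_algebra q)"
      unfolding r_def qmatrix_algebra_def by (rule residue_class_scalar_center)+
    show "r (var X * var Y - scalar q * (var U * var V))
        = r (var Y * var X - scalar (inverse q) * (var U * var V))"
      by (rule det)
    show "r (var Y * var V) = r (scalar (inverse q) * (var V * var Y))"
      by (rule vy)
    show "r (var U * var V) = r (var V * var U)"
      by (rule rel[symmetric]) (simp add: qmatrix_relations_def)
  qed (simp_all add: hom(1) inv, (rule rel, simp add: qmatrix_relations_def)+)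
qed

theorem theorem3p9:
  fixes q :: "'k::field_char_0"
  assumes "q \<noteq> 0"
  shows
    "let A = qmatrix_algebra q;
         x = qmatrix_gen q X; y = qmatrix_gen q Y; u = qmatrix_gen q U; v = qmatrix_gen q V;
         d = x \<otimes>\<^bsub>A\<^esub> y \<ominus>\<^bsub>A\<^esub> q \<odot>\<^bsub>A\<^esub> (u \<otimes>\<^bsub>A\<^esub> v)
     in (\<not> root_of_unity q \<longrightarrow> generated_subalgebra A {d} \<subseteq> center A) \<and>
        (\<forall>l::nat. primitive_root_of_unity l q \<longrightarrow>
           x [^]\<^bsub>A\<^esub> l \<in> center A \<and>
           y [^]\<^bsub>A\<^esub> l \<in> center A \<and>
           d \<in> center A \<and>
           (\<forall>i j::nat. i + j = l \<longrightarrow> u [^]\<^bsub>A\<^esub> i \<otimes>\<^bsub>A\<^esub> v [^]\<^bsub>A\<^esub> j \<in> center A) \<and>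
           generated_subalgebra A
             ({x [^]\<^bsub>A\<^esub> l, y [^]\<^bsub>A\<^esub> l, d} \<union>
              {u [^]\<^bsub>A\<^esub> i \<otimes>\<^bsub>A\<^esub> v [^]\<^bsub>A\<^esub> j | i j :: nat. i + j = l})
             \<subseteq> center A)"
proof -
  let ?A = "qmatrix_algebra q" and ?r = "residue_class (qmatrix_relations q)"
  let ?x = "qmatrix_gen q X" and ?y = "qmatrix_gen q Y"
    and ?u = "qmatrix_gen q U" and ?v = "qmatrix_gen q V"
  interpret quantum_matrix ?A "?r (scalar q)" "?r (scalar (inverse q))" ?x ?y ?u ?v
    using assms by (rule quantum_matrix_qmatrix_algebra)
  \<comment> \<open>This identifies the element \<open>d\<close> of the statement, which uses the
    field action, with \<open>det\<close> of the locale.\<close>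
  have smult: "q \<odot>\<^bsub>?A\<^esub> X = ?r (scalar q) \<otimes>\<^bsub>?A\<^esub> X" for X
    unfolding qmatrix_algebra_def presented_algebra_sel(6) ..
  have centerI: "z \<in> center ?A"
    if "z \<in> carrier ?A" "z \<otimes>\<^bsub>?A\<^esub> ?x = ?x \<otimes>\<^bsub>?A\<^esub> z" "z \<otimes>\<^bsub>?A\<^esub> ?y = ?y \<otimes>\<^bsub>?A\<^esub> z"
      "z \<otimes>\<^bsub>?A\<^esub> ?u = ?u \<otimes>\<^bsub>?A\<^esub> z" "z \<otimes>\<^bsub>?A\<^esub> ?v = ?v \<otimes>\<^bsub>?A\<^esub> z" for z
    unfolding qmatrix_algebra_def
  proof (rule center_presented_algebraI)
    show "z \<otimes>\<^bsub>presented_algebra (qmatrix_relations q)\<^esub> ?r (var g)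
        = ?r (var g) \<otimes>\<^bsub>presented_algebra (qmatrix_relations q)\<^esub> z" for g
      using that by (cases g) (simp_all add: qmatrix_algebra_def qmatrix_gen_def)
  qed (use that in \<open>simp add: qmatrix_algebra_def\<close>)
  have gen: "generated_subalgebra ?A T \<subseteq> center ?A" if "T \<subseteq> center ?A" for T
    using that unfolding qmatrix_algebra_def by (rule generated_subalgebra_subset_center)
  have det: "det \<in> center ?A"
    by (intro centerI det_closed det_x det_y det_u det_v)
  \<comment> \<open>Carries \<open>q^l = 1\<close> over from the field to the central element that
    plays the role of \<open>p\<close>.\<close>
  have pow: "?r (scalar c) [^]\<^bsub>?A\<^esub> n = ?r (scalar (c ^ n))" for c and n :: nat
    unfolding qmatrix_algebra_def
    by (induction n) (simp_all add: scalar_def mult_single mult.commute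
        flip: residue_class_simps single_one)
  have part2: "?x [^]\<^bsub>?A\<^esub> l \<in> center ?A" "?y [^]\<^bsub>?A\<^esub> l \<in> center ?A"
    "\<forall>i j. i + j = l \<longrightarrow> ?u [^]\<^bsub>?A\<^esub> i \<otimes>\<^bsub>?A\<^esub> ?v [^]\<^bsub>?A\<^esub> j \<in> center ?A"
    if "primitive_root_of_unity l q" for l
  proof -
    have l: "0 < l" "q ^ l = 1"
      using that by (auto simp: primitive_root_of_unity_def)
    have one: "?r (scalar 1) = \<one>\<^bsub>?A\<^esub>"
      unfolding qmatrix_algebra_def by (simp add: scalar_def flip: residue_class_simps(2))
    \<comment> \<open>The second equation serves the swapped locale, which supplies the centrality
      of \<open>y^l\<close> and the commutation of the monomials with \<open>y\<close>.\<close>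
    have pl: "?r (scalar q) [^]\<^bsub>?A\<^esub> l = \<one>\<^bsub>?A\<^esub>" "?r (scalar (inverse q)) [^]\<^bsub>?A\<^esub> l = \<one>\<^bsub>?A\<^esub>"
      using l one by (simp_all add: pow power_inverse)
    show "?x [^]\<^bsub>?A\<^esub> l \<in> center ?A"
      using closed l pl by (intro centerI pow_x_commutes) auto
    show "?y [^]\<^bsub>?A\<^esub> l \<in> center ?A"
      using closed l pl by (intro centerI quantum_matrix.pow_x_commutes[OF swap]) auto
    show "\<forall>i j. i + j = l \<longrightarrow> ?u [^]\<^bsub>?A\<^esub> i \<otimes>\<^bsub>?A\<^esub> ?v [^]\<^bsub>?A\<^esub> j \<in> center ?A"
      using closed pl
      by (intro allI impI centerI monomial_commutes quantum_matrix.monomial_commutes(1)[OF swap]) auto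
  qed
  show ?thesis
    unfolding Let_def smult
    using det part2 by (intro conjI allI impI gen) auto
qed

end
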